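(* For every finite rooted DAG $\mathcal{D}$ with node features and every directed acyclic GNN $\mathcal{A}_{\text{att}}$ with a standard attention mechanism, $$\mathcal{A}_{\text{att}}(\mathcal{D}) = \mathcal{A}_{\text{att}}(\gamma(\mathcal{D})),$$ where $\gamma(\mathcal{D})$ is the computation tree of $\mathcal{D}$.
   Context: Graphs. A directed graph is $\mathcal{G}=(\mathcal{V},\mathcal{E})$ with $\mathcal{V}$ finite and $\mathcal{E}\subseteq\mathcal{V}\times\mathcal{V}$; $(u,v)\in\mathcal{E}$ is the edge from $u$ to $v$. Write $\mathcal{N}_{\text{in}}(v)=\{u:(u,v)\in\mathcal{E}\}$ (predecessors) and $\mathcal{N}_{\text{out}}(v)=\{u:(v,u)\in\mathcal{E}\}$ (successors). A DAG is a directed graph without directed cycles. A rooted DAG is a DAG with a unique node $r$ (the root, or final node) having no successors. Every node $i$ carries an initial feature vector $\bm{h}_i\in\mathbb{R}^{\rho}$. Computation tree. For a rooted DAG $\mathcal{D}$ with root $r$, the computation tree $\gamma(\mathcal{D})$ is obtained by leaving each node with at most one successor unchanged and replacing any node $v$ with $n\ge 2$ successors by $n$ copies $v_1,\dots,v_n$ (carrying the same feature vector as $v$), each connected to exactly one of $v$'s successors and inheriting all of $v$'s incoming edges, until every node has at most one successor. The result is a rooted tree with root $r$. Equivalently: the nodes of $\gamma(\mathcal{D})$ are the directed paths of $\mathcal{D}$ ending in $r$ (including the trivial path at $r$); the path $(v_0,v_1,\dots,v_p=r)$ with $p\ge1$ has as its unique successor the path $(v_1,\dots,v_p)$; and the path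 starting at $v_0$ carries the feature $\bm{h}_{v_0}$. Standard-attention directed acyclic GNN. One layer is given by a scoring function $e$ (real-valued, with two vector arguments), a message function $f$ and an update function $\phi$ (arbitrary functions between real vector spaces of suitable finite dimensions). It processes the nodes of a DAG in an order compatible with the edges and computes $$\bm{h}_i' = \phi\Bigl(\bm{h}_i,\ \sum_{j\in\mathcal{N}_{\text{in}}(i)} \alpha_{ij}\, f(\bm{h}_j')\Bigr),\qquad \alpha_{ij}=\frac{\exp(e_{ij})}{\sum_{k\in\mathcal{N}_{\text{in}}(i)}\exp(e_{ik})},\qquad e_{ij}=e(\bm{h}_i,\bm{h}_j'),$$ where the empty sum (for nodes without predecessors) is $0$. A directed acyclic GNN with a standard attention mechanism, $\mathcal{A}_{\text{att}}$, is a composition of one or more such layers (each layer's outputs $\bm{h}_i'$ are the next layer's inputs $\bm{h}_i$), and its value $\mathcal{A}_{\text{att}}(\mathcal{D})$ on a rooted DAG $\mathcal{D}$ is the representation of the root $r$ after the last layer. *)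

theory Defs
  imports "Jordan_Normal_Form.Matrix"
begin

text \<open>Vectors of \<open>\<real>\<^sup>n\<close> are rendered by \<^term>\<open>carrier_vec n :: real vec set\<close>, so that the layers of a
  network may have different (arbitrary) dimensions.\<close>

record 'v featured_digraph =
  nodes :: "'v set"
  edges :: "('v \<times> 'v) set"
  feature :: "'v \<Rightarrow> real vec"

definition in_nbrs :: "('v \<times> 'v) set \<Rightarrow> 'v \<Rightarrow> 'v set"
  where "in_nbrs E v = {u. (u, v) \<in> E}"

definition out_nbrs :: "('v \<times> 'v) set \<Rightarrow> 'v \<Rightarrow> 'v set"
  where "out_nbrs E v = {u. (v, u) \<in> E}"

definition is_root :: "('v, 'z) featured_digraph_scheme \<Rightarrow> 'v \<Rightarrow> bool"
  where "is_root D r \<longleftrightarrow> r \<in> nodes D \<and> out_nbrs (edges D) r = {}"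

definition rooted_dag :: "('v, 'z) featured_digraph_scheme \<Rightarrow> bool"
  where "rooted_dag D \<longleftrightarrow>
    finite (nodes D) \<and> edges D \<subseteq> nodes D \<times> nodes D \<and> acyclic (edges D) \<and> (\<exists>!r. is_root D r)"

definition dag_root :: "('v, 'z) featured_digraph_scheme \<Rightarrow> 'v"
  where "dag_root D = (THE r. is_root D r)"


subsection \<open>Computation trees\<close>

text \<open>A directed path \<open>(v\<^sub>0, \<dots>, v\<^sub>p)\<close> is the nonempty list of its nodes; \<open>p = 0\<close> is the trivial path.\<close>

definition root_paths :: "('v, 'z) featured_digraph_scheme \<Rightarrow> 'v list set"
  where "root_paths D = {p. p \<noteq> [] \<and> set p \<subseteq> nodes D \<and>
    successively (\<lambda>u v. (u, v) \<in> edges D) p \<and> last p = dag_root D}"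

definition comp_tree :: "'v featured_digraph \<Rightarrow> 'v list featured_digraph"
  where "comp_tree D =
    \<lparr>nodes = root_paths D,
     edges = {(v # p, p) | v p. v # p \<in> root_paths D \<and> p \<in> root_paths D},
     feature = (\<lambda>p. feature D (hd p))\<rparr>"


subsection \<open>Standard-attention directed acyclic GNNs\<close>

record att_layer =
  in_dim :: nat
  msg_dim :: nat
  out_dim :: nat
  score :: "real vec \<Rightarrow> real vec \<Rightarrow> real"
  message :: "real vec \<Rightarrow> real vec"
  update :: "real vec \<Rightarrow> real vec \<Rightarrow> real vec"

definition wf_layer :: "att_layer \<Rightarrow> bool"
  where "wf_layer L \<longleftrightarrow>
    message L \<in> carrier_vec (out_dim L) \<rightarrow> carrier_vec (msg_dim L) \<and>
    update L \<in> carrier_vec (in_dim L) \<rightarrow> carrier_vec (msg_dim L) \<rightarrow> carrier_vec (out_dim L)"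

text \<open>Below, \<open>h\<close> are the layer's inputs and \<open>h'\<close> its outputs, as far as already computed.\<close>

definition att_coeff ::
  "att_layer \<Rightarrow> ('v \<times> 'v) set \<Rightarrow> ('v \<Rightarrow> real vec) \<Rightarrow> ('v \<Rightarrow> real vec) \<Rightarrow> 'v \<Rightarrow> 'v \<Rightarrow> real"
  where "att_coeff L E h h' i j =
    exp (score L (h i) (h' j)) / (\<Sum>k\<in>in_nbrs E i. exp (score L (h i) (h' k)))"

definition layer_step ::
  "att_layer \<Rightarrow> ('v \<times> 'v) set \<Rightarrow> ('v \<Rightarrow> real vec) \<Rightarrow> ('v \<Rightarrow> real vec) \<Rightarrow> 'v \<Rightarrow> real vec"
  where "layer_step L E h h' i =
    update L (h i)
      (finsum_vec TYPE(real) (msg_dim L)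
        (\<lambda>j. att_coeff L E h h' i j \<cdot>\<^sub>v message L (h' j)) (in_nbrs E i))"

text \<open>Processing the nodes in an order compatible with the edges is well-founded recursion along
  the edge relation; \<open>layer_out_eq\<close> below gives the resulting equation.\<close>

definition layer_out ::
  "att_layer \<Rightarrow> ('v \<times> 'v) set \<Rightarrow> ('v \<Rightarrow> real vec) \<Rightarrow> 'v \<Rightarrow> real vec"
  where "layer_out L E h = wfrec E (layer_step L E h)"

text \<open>A network is the list of its layers, the first layer being applied first.\<close>

definition att_dagnn :: "nat \<Rightarrow> att_layer list \<Rightarrow> bool"
  where "att_dagnn \<rho> Ls \<longleftrightarrow>
    Ls \<noteq> [] \<and> (\<forall>L\<in>set Ls. wf_layer L) \<and> in_dim (hd Ls) = \<rho> \<and>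
    successively (\<lambda>L M. out_dim L = in_dim M) Ls"

definition gnn_repr :: "att_layer list \<Rightarrow> ('v, 'z) featured_digraph_scheme \<Rightarrow> 'v \<Rightarrow> real vec"
  where "gnn_repr Ls D = fold (\<lambda>L h. layer_out L (edges D) h) Ls (feature D)"

definition gnn_value :: "att_layer list \<Rightarrow> ('v, 'z) featured_digraph_scheme \<Rightarrow> real vec"
  where "gnn_value Ls D = gnn_repr Ls D (dag_root D)"


subsection \<open>Well-definedness\<close>

lemma rooted_dag_wf:
  assumes "rooted_dag D"
  shows "wf (edges D)"
proof (rule finite_acyclic_wf)
  show "finite (edges D)"
    using assms unfolding rooted_dag_def by (meson finite_SigmaI finite_subset)
  show "acyclic (edges D)"
    using assms by (simp add: rooted_dag_def)
qed

lemma layer_step_carrier: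
  assumes "wf_layer L" "h i \<in> carrier_vec (in_dim L)"
    and "\<And>j. j \<in> in_nbrs E i \<Longrightarrow> h' j \<in> carrier_vec (out_dim L)"
  shows "layer_step L E h h' i \<in> carrier_vec (out_dim L)"
proof -
  have "finsum_vec TYPE(real) (msg_dim L)
      (\<lambda>j. att_coeff L E h h' i j \<cdot>\<^sub>v message L (h' j)) (in_nbrs E i) \<in> carrier_vec (msg_dim L)"
    using assms by (intro finsum_vec_closed) (auto simp: wf_layer_def)
  then show ?thesis
    using assms(1,2) unfolding layer_step_def wf_layer_def by blast
qed

lemma layer_step_cong:
  assumes "wf_layer L"
    and "\<And>j. j \<in> in_nbrs E i \<Longrightarrow> h' j \<in> carrier_vec (out_dim L)"
    and "\<And>j. j \<in> in_nbrs E i \<Longrightarrow> g j = h' j"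
  shows "layer_step L E h g i = layer_step L E h h' i"
proof -
  have "att_coeff L E h g i j = att_coeff L E h h' i j" if "j \<in> in_nbrs E i" for j
    unfolding att_coeff_def using assms(3) that by (simp cong: sum.cong)
  then have "finsum_vec TYPE(real) (msg_dim L)
      (\<lambda>j. att_coeff L E h g i j \<cdot>\<^sub>v message L (g j)) (in_nbrs E i) =
    finsum_vec TYPE(real) (msg_dim L)
      (\<lambda>j. att_coeff L E h h' i j \<cdot>\<^sub>v message L (h' j)) (in_nbrs E i)"
    using assms unfolding finsum_vec_def
    by (intro comm_monoid.finprod_cong' comm_monoid_vec)
      (auto simp: wf_layer_def monoid_vec_simps)
  then show ?thesis
    by (simp add: layer_step_def)
qed

lemma
  assumes "rooted_dag D" "wf_layer L" "\<And>v. v \<in> nodes D \<Longrightarrow> h v \<in> carrier_vec (in_dim L)"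
    and "i \<in> nodes D"
  shows layer_out_carrier: "layer_out L (edges D) h i \<in> carrier_vec (out_dim L)"
    and layer_out_eq:
      "layer_out L (edges D) h i = layer_step L (edges D) h (layer_out L (edges D) h) i"
proof -
  let ?h = "layer_out L (edges D) h"
  have E: "edges D \<subseteq> nodes D \<times> nodes D"
    using assms(1) by (simp add: rooted_dag_def)
  have step: "?h v = layer_step L (edges D) h ?h v"
    if "\<And>j. j \<in> in_nbrs (edges D) v \<Longrightarrow> ?h j \<in> carrier_vec (out_dim L)" for v
  proof -
    have "?h v = layer_step L (edges D) h (cut ?h (edges D) v) v"
      unfolding layer_out_def by (rule wfrec[OF rooted_dag_wf[OF assms(1)]])
    also have "\<dots> = layer_step L (edges D) h ?h v"
      by (rule layer_step_cong[OF assms(2) that]) (auto simp: in_nbrs_def cut_def)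
    finally show ?thesis .
  qed
  have carrier: "v \<in> nodes D \<longrightarrow> ?h v \<in> carrier_vec (out_dim L)" for v
  proof (induction v rule: wf_induct_rule[OF rooted_dag_wf[OF assms(1)]])
    case (1 v)
    have preds: "?h j \<in> carrier_vec (out_dim L)" if "j \<in> in_nbrs (edges D) v" for j
      using 1 that E by (auto simp: in_nbrs_def)
    have eq: "?h v = layer_step L (edges D) h ?h v"
      by (rule step) (rule preds)
    show ?case
    proof
      assume "v \<in> nodes D"
      then have "layer_step L (edges D) h ?h v \<in> carrier_vec (out_dim L)"
        by (intro layer_step_carrier[OF assms(2)] assms(3) preds)
      then show "?h v \<in> carrier_vec (out_dim L)"
        by (rule ssubst[OF eq, of "\<lambda>x. x \<in> carrier_vec (out_dim L)"])
    qed
  qed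
  show "?h i \<in> carrier_vec (out_dim L)"
    using carrier assms(4) by blast
  show "?h i = layer_step L (edges D) h ?h i"
  proof (rule step)
    fix j
    assume "j \<in> in_nbrs (edges D) i"
    then have "j \<in> nodes D"
      using E by (auto simp: in_nbrs_def)
    then show "?h j \<in> carrier_vec (out_dim L)"
      using carrier by blast
  qed
qed

lemma rooted_dag_comp_tree:
  assumes "rooted_dag D"
  shows "rooted_dag (comp_tree D)" and "dag_root (comp_tree D) = [dag_root D]"
proof -
  have V: "finite (nodes D)" and acyc: "acyclic (edges D)" and ex: "\<exists>!r. is_root D r"
    using assms by (simp_all add: rooted_dag_def)
  have "is_root D (dag_root D)"
    unfolding dag_root_def by (rule theI'[OF ex])
  then have r: "[dag_root D] \<in> root_paths D"
    by (simp add: root_paths_def is_root_def)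
  have "distinct p" if "successively (\<lambda>u v. (u, v) \<in> edges D) p" for p
  proof -
    have "successively (\<lambda>u v. (u, v) \<in> (edges D)\<^sup>+) p"
      using that by (rule successively_mono) auto
    then have "sorted_wrt (\<lambda>u v. (u, v) \<in> (edges D)\<^sup>+) p"
      by (subst (asm) successively_conv_sorted_wrt) (auto intro: transpI trancl_trans)
    then show ?thesis
      using acyc by (induction p) (auto simp: acyclic_def)
  qed
  then have "root_paths D \<subseteq> {p. set p \<subseteq> nodes D \<and> distinct p}"
    by (auto simp: root_paths_def)
  then have fin: "finite (nodes (comp_tree D))"
    using finite_subset_distinct[OF V] by (simp add: comp_tree_def finite_subset)
  have "acyclic ((measure length)\<inverse>)"
    by (simp add: wf_acyclic)
  then have ac: "acyclic (edges (comp_tree D))"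
    by (rule acyclic_subset) (auto simp: comp_tree_def)
  have roots: "is_root (comp_tree D) p \<longleftrightarrow> p = [dag_root D]" for p
  proof
    assume p: "is_root (comp_tree D) p"
    then have "p \<in> root_paths D"
      by (simp add: is_root_def comp_tree_def)
    moreover from this obtain v q where "p = v # q"
      by (cases p) (auto simp: root_paths_def)
    moreover have "q \<notin> root_paths D"
      using p calculation by (auto simp: is_root_def comp_tree_def out_nbrs_def)
    ultimately show "p = [dag_root D]"
      by (auto simp: root_paths_def successively_Cons split: if_splits)
  next
    assume "p = [dag_root D]"
    then show "is_root (comp_tree D) p"
      using r by (auto simp: is_root_def comp_tree_def out_nbrs_def root_paths_def)
  qed
  show "rooted_dag (comp_tree D)"
    using fin ac roots by (auto simp: rooted_dag_def comp_tree_def)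
  show "dag_root (comp_tree D) = [dag_root D]"
    by (simp add: dag_root_def roots)
qed

end

theory Submission imports Defs begin

text \<open>
  Sending a path of the computation tree to its first node maps the predecessors of every path
  bijectively onto the predecessors of its first node, i.e. it is a graph fibration. Attention
  coefficients and aggregated messages at a node only depend on the representations of the node
  and of its predecessors, so by induction along the edges each layer commutes with pulling
  features back along a fibration; and the root of the tree lies over the root of the DAG.
\<close>

definition fibration ::
  "('u, 'y) featured_digraph_scheme \<Rightarrow> ('v, 'z) featured_digraph_scheme \<Rightarrow> ('u \<Rightarrow> 'v) \<Rightarrow> bool"
  where "fibration T D f \<longleftrightarrow> f \<in> nodes T \<rightarrow> nodes D \<and>
    (\<forall>t\<in>nodes T. bij_betw f (in_nbrs (edges T) t) (in_nbrs (edges D) (f t)))"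

text \<open>Both the softmax denominator and the sum of messages range over predecessors, so each
  can be reindexed along the bijection \<open>f\<close>. The two layer inputs are compared only at
  the node itself, the outputs \<open>g\<close> and \<open>g'\<close> only at predecessors.\<close>

lemma layer_step_bij_betw:
  assumes "wf_layer L"
    and bij: "bij_betw f (in_nbrs E' t) (in_nbrs E (f t))"
    and h: "h' t = h (f t)"
    and carrier: "\<And>j. j \<in> in_nbrs E (f t) \<Longrightarrow> g j \<in> carrier_vec (out_dim L)"
    and g: "\<And>s. s \<in> in_nbrs E' t \<Longrightarrow> g' s = g (f s)"
  shows "layer_step L E' h' g' t = layer_step L E h g (f t)"
proof -
  have img: "f ` in_nbrs E' t = in_nbrs E (f t)" and inj: "inj_on f (in_nbrs E' t)"
    using bij by (auto simp: bij_betw_def)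
  have coeff: "att_coeff L E' h' (\<lambda>s. g (f s)) t s = att_coeff L E h g (f t) (f s)" for s
    unfolding att_coeff_def h
    using sum.reindex_bij_betw[OF bij, of "\<lambda>k. exp (score L (h (f t)) (g k))"] by simp
  have "layer_step L E' h' g' t = layer_step L E' h' (\<lambda>s. g (f s)) t"
    using assms(1) carrier g img by (intro layer_step_cong) auto
  \<comment> \<open>This equation is not a link of the calculation but feeds the next one.
    \<open>finsum_vec\<close> is a product in the monoid of vectors of fixed dimension, so
    reindexing needs injectivity of \<open>f\<close> and summands in the carrier.\<close>
  also have "finsum_vec TYPE(real) (msg_dim L)
      (\<lambda>j. att_coeff L E h g (f t) j \<cdot>\<^sub>v message L (g j)) (f ` in_nbrs E' t) =
    finsum_vec TYPE(real) (msg_dim L)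
      (\<lambda>s. att_coeff L E h g (f t) (f s) \<cdot>\<^sub>v message L (g (f s))) (in_nbrs E' t)"
    using assms(1) carrier img inj unfolding finsum_vec_def
    by (intro comm_monoid.finprod_reindex comm_monoid_vec)
      (auto simp: wf_layer_def monoid_vec_simps)
  then have "layer_step L E' h' (\<lambda>s. g (f s)) t = layer_step L E h g (f t)"
    by (simp add: layer_step_def coeff h img)
  finally show ?thesis .
qed

text \<open>Both sides unfold once by the recursion equation \<open>layer_out_eq\<close>.
  Predecessors of \<open>t\<close> are nodes of \<open>T\<close>, so the induction hypothesis gives
  the agreement that \<open>layer_step_bij_betw\<close> asks for.\<close>

lemma layer_out_fibration:
  assumes D: "rooted_dag D" and T: "rooted_dag T" and fib: "fibration T D f"
    and L: "wf_layer L"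
    and carrier: "\<And>v. v \<in> nodes D \<Longrightarrow> h v \<in> carrier_vec (in_dim L)"
    and h: "\<And>t. t \<in> nodes T \<Longrightarrow> h' t = h (f t)"
    and "t \<in> nodes T"
  shows "layer_out L (edges T) h' t = layer_out L (edges D) h (f t)"
  using \<open>t \<in> nodes T\<close>
proof (induction t rule: wf_induct_rule[OF rooted_dag_wf[OF T]])
  case (1 t)
  have f: "f s \<in> nodes D" if "s \<in> nodes T" for s
    using fib that by (auto simp: fibration_def)
  \<comment> \<open>Pulled-back features inherit their dimension from \<open>D\<close>, so the
    recursion equation applies on \<open>T\<close> too.\<close>
  have carrier': "h' s \<in> carrier_vec (in_dim L)" if "s \<in> nodes T" for s
    using carrier f h that by simp
  have edges: "edges D \<subseteq> nodes D \<times> nodes D" "edges T \<subseteq> nodes T \<times> nodes T"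
    using D T by (simp_all add: rooted_dag_def)
  have "layer_out L (edges T) h' t = layer_step L (edges T) h' (layer_out L (edges T) h') t"
    using T L carrier' 1(2) by (rule layer_out_eq)
  also have "\<dots> = layer_step L (edges D) h (layer_out L (edges D) h) (f t)"
  proof (rule layer_step_bij_betw[OF L])
    show "bij_betw f (in_nbrs (edges T) t) (in_nbrs (edges D) (f t))"
      using fib 1(2) by (simp add: fibration_def)
    show "h' t = h (f t)"
      using 1(2) by (rule h)
    show "layer_out L (edges D) h j \<in> carrier_vec (out_dim L)" if "j \<in> in_nbrs (edges D) (f t)" for j
      using that edges by (intro layer_out_carrier[OF D L carrier]) (auto simp: in_nbrs_def)
    show "layer_out L (edges T) h' s = layer_out L (edges D) h (f s)"
      if "s \<in> in_nbrs (edges T) t" for s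
      using that edges 1(1) by (auto simp: in_nbrs_def)
  qed
  also have "\<dots> = layer_out L (edges D) h (f t)"
    using D L carrier f[OF 1(2)] by (rule layer_out_eq[symmetric])
  finally show ?case .
qed

text \<open>The outputs of one layer are the inputs of the rest, hence \<open>h\<close> and
  \<open>h'\<close> are arbitrary in the induction. The dimension hypothesis is guarded by
  \<open>Ls \<noteq> []\<close> because \<open>hd []\<close> is unspecified.\<close>

lemma fold_layer_out_fibration:
  assumes D: "rooted_dag D" and T: "rooted_dag T" and fib: "fibration T D f"
    and "\<And>L. L \<in> set Ls \<Longrightarrow> wf_layer L"
    and "successively (\<lambda>L M. out_dim L = in_dim M) Ls"
    and "\<And>v. Ls \<noteq> [] \<Longrightarrow> v \<in> nodes D \<Longrightarrow> h v \<in> carrier_vec (in_dim (hd Ls))"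
    and "\<And>t. t \<in> nodes T \<Longrightarrow> h' t = h (f t)"
    and "t \<in> nodes T"
  shows "fold (\<lambda>L. layer_out L (edges T)) Ls h' t = fold (\<lambda>L. layer_out L (edges D)) Ls h (f t)"
  using assms(4-8)
proof (induction Ls arbitrary: h h')
  case Nil
  then show ?case by simp
next
  case (Cons L Ls)
  have L: "wf_layer L" and carrier: "\<And>v. v \<in> nodes D \<Longrightarrow> h v \<in> carrier_vec (in_dim L)"
    using Cons.prems by auto
  have "fold (\<lambda>L. layer_out L (edges T)) Ls (layer_out L (edges T) h') t =
    fold (\<lambda>L. layer_out L (edges D)) Ls (layer_out L (edges D) h) (f t)"
  proof (rule Cons.IH)
    \<comment> \<open>Dimensions of consecutive layers match: \<open>out_dim L\<close> is
      \<open>in_dim (hd Ls)\<close>.\<close>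
    show "layer_out L (edges D) h v \<in> carrier_vec (in_dim (hd Ls))"
      if "Ls \<noteq> []" "v \<in> nodes D" for v
      using layer_out_carrier[OF D L carrier that(2)] Cons.prems(2) that(1)
      by (simp add: successively_Cons)
    show "layer_out L (edges T) h' s = layer_out L (edges D) h (f s)" if "s \<in> nodes T" for s
      using D T fib L carrier Cons.prems(4) that by (rule layer_out_fibration)
  qed (use Cons.prems in \<open>auto simp: successively_Cons\<close>)
  then show ?case by simp
qed

lemma gnn_repr_fibration:
  assumes "rooted_dag D" "rooted_dag T" "fibration T D f"
    and "\<And>v. v \<in> nodes D \<Longrightarrow> feature D v \<in> carrier_vec \<rho>"
    and "\<And>t. t \<in> nodes T \<Longrightarrow> feature T t = feature D (f t)"
    and "att_dagnn \<rho> Ls" and "t \<in> nodes T"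
  shows "gnn_repr Ls T t = gnn_repr Ls D (f t)"
  unfolding gnn_repr_def using assms
  by (intro fold_layer_out_fibration) (auto simp: att_dagnn_def)

text \<open>A path is extended at the front by exactly the predecessors of its first node, and
  \<open>hd\<close> inverts the extension \<open>u # p\<close>.\<close>

lemma fibration_comp_tree:
  assumes "rooted_dag D"
  shows "fibration (comp_tree D) D hd"
proof -
  \<comment> \<open>Edges of \<open>D\<close> join nodes of \<open>D\<close>, so prepending a
    predecessor again yields a path within \<open>nodes D\<close>.\<close>
  have "in_nbrs (edges (comp_tree D)) p = (\<lambda>u. u # p) ` in_nbrs (edges D) (hd p)"
    if "p \<in> root_paths D" for p
    using that assms
    by (auto simp: in_nbrs_def comp_tree_def root_paths_def successively_Cons rooted_dag_def)
  then have "bij_betw hd (in_nbrs (edges (comp_tree D)) p) (in_nbrs (edges D) (hd p))"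
    if "p \<in> root_paths D" for p
    using that by (auto simp: bij_betw_def inj_on_def image_image)
  moreover have "hd p \<in> nodes D" if "p \<in> root_paths D" for p
    using that by (auto simp: root_paths_def)
  ultimately show ?thesis
    by (simp add: fibration_def comp_tree_def)
qed

theorem corollary4p2:
  fixes D :: "'v featured_digraph" and A :: "att_layer list" and \<rho> :: nat
  assumes "rooted_dag D"
    and "\<And>v. v \<in> nodes D \<Longrightarrow> feature D v \<in> carrier_vec \<rho>"
    and "att_dagnn \<rho> A"
  shows "gnn_value A D = gnn_value A (comp_tree D)"
proof -
  note T = rooted_dag_comp_tree[OF assms(1)]
  \<comment> \<open>This makes the trivial path a node of the tree, where the fibration result can
    be evaluated.\<close>
  have "is_root (comp_tree D) [dag_root D]"
    using T theI'[of "is_root (comp_tree D)"] by (simp add: rooted_dag_def dag_root_def)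
  then have "gnn_repr A (comp_tree D) [dag_root D] = gnn_repr A D (hd [dag_root D])"
    using assms T(1) fibration_comp_tree[OF assms(1)]
    by (intro gnn_repr_fibration) (auto simp: comp_tree_def is_root_def)
  then show ?thesis
    by (simp add: gnn_value_def T(2))
qed

end
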